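(* Let $q$ be a prime power, $n\ge 9$ an odd integer, $\lambda_2=\frac{q^{n-1}-q^3}{q-1}-q-1$, and let $\mathcal L$ be a set of planes of ${\rm PG}(n,q)$ and $x>0$ an integer such that every plane not in $\mathcal L$ meets exactly $x$ planes of $\mathcal L$ in a line and every plane of $\mathcal L$ meets exactly $\lambda_2+x$ other planes of $\mathcal L$ in a line. Then $x\ge (q+1)(q^2+q+1)$, and if equality holds, then there is a line spread $S$ of ${\rm PG}(n,q)$ such that $\mathcal L$ consists of all planes containing a line of $S$.
   Context: A plane is a 2-dimensional projective subspace. A line spread of ${\rm PG}(n,q)$ is a set of lines partitioning the point set. *)

theory Defs
  imports "HOL-Analysis.Cartesian_Space" "HOL-Library.Disjoint_Sets"
begin

(* PG(n,q) is the lattice of linear subspaces of F^(n+1), where F is a finite field with q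
   elements.  Here F is a type 'a of class {field, finite} with CARD('a) = q, and F^(n+1) is
   'a ^ 'n with CARD('n) = n + 1.  A projective subspace is represented by the set of vectors of
   the underlying linear subspace, so incidence is set inclusion, the meet of two projective
   subspaces is their intersection, and projective dimension k is linear dimension k + 1. *)

definition proj_subspace :: "nat \<Rightarrow> (('a::field) ^ 'n) set \<Rightarrow> bool" where
  "proj_subspace k U \<longleftrightarrow> vec.subspace U \<and> vec.dim U = k + 1"

abbreviation pg_point :: "(('a::field) ^ 'n) set \<Rightarrow> bool" where
  "pg_point \<equiv> proj_subspace 0"

abbreviation pg_line :: "(('a::field) ^ 'n) set \<Rightarrow> bool" where
  "pg_line \<equiv> proj_subspace 1"

abbreviation pg_plane :: "(('a::field) ^ 'n) set \<Rightarrow> bool" where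
  "pg_plane \<equiv> proj_subspace 2"

definition points_on :: "(('a::field) ^ 'n) set \<Rightarrow> ('a ^ 'n) set set" where
  "points_on U = {p. pg_point p \<and> p \<subseteq> U}"

definition line_spread :: "(('a::field) ^ 'n) set set \<Rightarrow> bool" where
  "line_spread S \<longleftrightarrow>
     (\<forall>l\<in>S. pg_line l) \<and> partition_on {p. pg_point p} (points_on ` S)"

end

theory Submission
  imports Defs
begin

text \<open>Let \<open>m(l)\<close> be the number of planes of \<open>\<L>\<close> on a line \<open>l\<close> and \<open>N = (q\<^sup>n\<^sup>-\<^sup>1 - 1)/(q - 1)\<close>
  the number of all planes on \<open>l\<close>. The hypothesis says that the sum of \<open>m(l)\<close> over the lines of a
  plane is \<open>x + N - q - 1\<close> if the plane is in \<open>\<L>\<close> and \<open>x\<close> if it is not. So \<open>m(l) > x\<close> forces all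
  planes on \<open>l\<close> to be in \<open>\<L>\<close>; call such a line full, so that \<open>m(l) = N\<close>. Suppose
  \<open>x \<le> (q + 1)(q\<^sup>2 + q + 1)\<close>. Since \<open>N\<close> has order \<open>q\<^sup>7\<close> or more, a plane of \<open>\<L>\<close> can have neither
  no full line nor two of them. Hence the planes of \<open>\<L>\<close> are the planes on a full line, and full
  lines are pairwise disjoint. For a line that is not full, \<open>m(l)\<close> is the number of its points on
  full lines, and so the sums above show that all planes have the same number \<open>x/(q + 1)\<close> of points
  on full lines. Counting over the planes on a line, all lines have the same number of such points,
  and it is \<open>q + 1\<close> for a full line. So the full lines form a spread and
  \<open>x/(q + 1) = q\<^sup>2 + q + 1\<close>.\<close>

section \<open>Counting vectors and subspaces over a finite field\<close>

lemma card_field_ge_2: "CARD('a::{field,finite}) \<ge> 2"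
proof -
  have "card {0, 1 :: 'a} \<le> CARD('a)"
    by (rule card_mono) auto
  then show ?thesis by simp
qed

lemma card_subspace:
  fixes U :: "(('a::{field,finite}) ^ 'n) set"
  assumes "vec.subspace U"
  shows "card U = CARD('a) ^ vec.dim U"
proof -
  have span: "card (vec.span B) = CARD('a) ^ card B"
    if "vec.independent B" for B :: "('a ^ 'n) set"
    using finite[of B] that
  proof (induction B rule: finite_induct)
    case empty
    then show ?case by simp
  next
    case (insert b B)
    then have b: "b \<notin> vec.span B" and B: "vec.independent B"
      by (auto simp: vec.independent_insert)
    \<comment> \<open>Each vector of the larger span is \<open>c *s b + u\<close> for exactly one
      pair, so a new basis vector multiplies the cardinality by \<open>CARD('a)\<close>.\<close>
    let ?f = "\<lambda>(c, u). c *s b + u"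
    have "inj_on ?f (UNIV \<times> vec.span B)"
    proof (rule inj_onI, clarify)
      fix c d u v
      assume u: "u \<in> vec.span B" and v: "v \<in> vec.span B"
        and eq: "c *s b + u = d *s b + v"
      then have diff: "(c - d) *s b = v - u"
        by (simp add: vec.scale_left_diff_distrib algebra_simps)
      have "c = d"
      proof (rule ccontr)
        assume "c \<noteq> d"
        have "(1 / (c - d)) *s ((c - d) *s b) \<in> vec.span B"
          unfolding diff using u v by (intro vec.span_scale vec.span_diff)
        with \<open>c \<noteq> d\<close> b show False by simp
      qed
      with eq show "c = d \<and> u = v" by simp
    qed
    moreover have "?f ` (UNIV \<times> vec.span B) = vec.span (insert b B)"
    proof (intro equalityI subsetI)
      fix y assume "y \<in> ?f ` (UNIV \<times> vec.span B)"
      then show "y \<in> vec.span (insert b B)"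
        by (auto intro!: vec.span_add vec.span_scale vec.span_base[of b]
            intro: subsetD[OF vec.span_mono])
    next
      fix y assume "y \<in> vec.span (insert b B)"
      then obtain k where "y - k *s b \<in> vec.span B"
        by (auto simp: vec.span_breakdown_eq)
      then show "y \<in> ?f ` (UNIV \<times> vec.span B)"
        by (intro image_eqI[of _ _ "(k, y - k *s b)"]) auto
    qed
    ultimately have "card (vec.span (insert b B)) = card (UNIV \<times> vec.span B :: ('a \<times> _) set)"
      using card_image by fastforce
    with insert B show ?case by (simp add: card_cartesian_product)
  qed
  obtain B where "vec.independent B" "vec.span B = U" "card B = vec.dim U"
    using vec.basis_subspace_exists[OF assms] by metis
  with span show ?thesis by metis
qed

text \<open>For subspaces \<open>A \<subseteq> B\<close> these correspond to the points of the
  quotient \<open>B / A\<close>. The notion treats lines through a point of a plane and planes on a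
  line alike.\<close>

definition covers :: "(('a::field) ^ 'n) set \<Rightarrow> ('a ^ 'n) set \<Rightarrow> ('a ^ 'n) set set" where
  "covers A B = {U. vec.subspace U \<and> vec.dim U = Suc (vec.dim A) \<and> A \<subseteq> U \<and> U \<subseteq> B}"

text \<open>A cover containing \<open>w\<close> contains this span, which already has the dimension
  of the cover. So the covers partition \<open>B - A\<close>, apart from \<open>A\<close>
  itself.\<close>

lemma covers_through:
  assumes "vec.subspace A" "vec.subspace B" "A \<subseteq> B" "w \<in> B" "w \<notin> A"
  shows "{U \<in> covers A B. w \<in> U} = {vec.span (insert w A)}"
proof -
  let ?V = "vec.span (insert w A)"
  have dim: "vec.dim ?V = Suc (vec.dim A)"
    using assms by (metis Suc_eq_plus1 vec.dim_insert vec.dim_span vec.span_eq_iff)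
  have "A \<subseteq> ?V" "w \<in> ?V"
    by (auto intro: vec.span_base)
  moreover have "?V \<subseteq> B"
    using assms by (intro vec.span_minimal) auto
  ultimately have "?V \<in> {U \<in> covers A B. w \<in> U}"
    using dim by (simp add: covers_def)
  moreover have "U = ?V" if U: "U \<in> covers A B" "w \<in> U" for U
  proof -
    have "?V \<subseteq> U" using U by (intro vec.span_minimal) (auto simp: covers_def)
    then show ?thesis
      using U dim vec.subspace_dim_equal[of ?V U] by (simp add: covers_def)
  qed
  ultimately show ?thesis by blast
qed

lemma sum_card_covers:
  fixes A B :: "(('a::{field,finite}) ^ 'n) set"
  assumes "vec.subspace A" "vec.subspace B" "A \<subseteq> B"
  shows "(\<Sum>U \<in> covers A B. card (W \<inter> U - A)) = card (W \<inter> B - A)"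
proof -
  have "(\<Sum>U \<in> covers A B. card {w \<in> W \<inter> B - A. w \<in> U}) = (\<Sum>w \<in> W \<inter> B - A. 1)"
    by (rule sum_multicount_gen) (use assms in \<open>auto simp: covers_through\<close>)
  moreover have "{w \<in> W \<inter> B - A. w \<in> U} = W \<inter> U - A" if "U \<in> covers A B" for U
    using that by (auto simp: covers_def)
  ultimately show ?thesis by simp
qed

text \<open>Each cover adds \<open>q ^ Suc a - q ^ a\<close> vectors to \<open>A\<close>, and
  together they add \<open>q ^ b - q ^ a\<close>; the quotient is a geometric sum.\<close>

lemma card_covers:
  fixes A B :: "(('a::{field,finite}) ^ 'n) set"
  assumes "vec.subspace A" "vec.subspace B" "A \<subseteq> B"
  shows "card (covers A B) = (\<Sum>i<vec.dim B - vec.dim A. CARD('a) ^ i)"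
proof -
  let ?q = "int CARD('a)" and ?a = "vec.dim A" and ?b = "vec.dim B"
  have le: "?a \<le> ?b" using assms by (intro vec.dim_subset)
  have diff: "int (card (U - A)) = ?q ^ vec.dim U - ?q ^ ?a"
    if "vec.subspace U" "A \<subseteq> U" for U
    using that assms
    by (simp add: card_Diff_subset card_subspace[symmetric] of_nat_diff card_mono flip: of_nat_power)
  have "int (\<Sum>U \<in> covers A B. card (U - A)) = int (card (B - A))"
    using sum_card_covers[OF assms, of UNIV] by simp
  moreover have "int (\<Sum>U \<in> covers A B. card (U - A)) = (\<Sum>U \<in> covers A B. ?q ^ Suc ?a - ?q ^ ?a)"
    unfolding of_nat_sum using diff by (intro sum.cong) (auto simp: covers_def)
  ultimately have "int (card (covers A B)) * (?q ^ Suc ?a - ?q ^ ?a) = ?q ^ ?b - ?q ^ ?a"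
    using diff[of B] assms by simp
  moreover have "?q ^ ?b = ?q ^ ?a * ?q ^ (?b - ?a)"
    using le by (simp flip: power_add)
  ultimately have "?q ^ ?a * (int (card (covers A B)) * (?q - 1)) = ?q ^ ?a * (?q ^ (?b - ?a) - 1)"
    by (simp add: algebra_simps)
  then have "int (card (covers A B)) * (?q - 1) = ?q ^ (?b - ?a) - 1"
    by simp
  also have "\<dots> = (\<Sum>i<?b - ?a. ?q ^ i) * (?q - 1)"
    by (simp add: power_diff_1_eq mult.commute)
  finally have "int (card (covers A B)) = int (\<Sum>i<?b - ?a. CARD('a) ^ i)"
    using card_field_ge_2[where 'a = 'a] by simp
  then show ?thesis by (simp only: of_nat_eq_iff)
qed

section \<open>Incidence of lines and planes\<close>

definition lines_in :: "(('a::field) ^ 'n) set \<Rightarrow> ('a ^ 'n) set set" where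
  "lines_in U = {l. pg_line l \<and> l \<subseteq> U}"

lemma card_lines_through_point:
  fixes \<pi> :: "(('a::{field,finite}) ^ 'n) set"
  assumes "pg_plane \<pi>" "w \<in> \<pi>" "w \<noteq> 0"
  shows "card {l \<in> lines_in \<pi>. w \<in> l} = CARD('a) + 1"
proof -
  have sub: "vec.subspace \<pi>" "vec.dim \<pi> = 3"
    using assms by (auto simp: proj_subspace_def)
  have "{l \<in> lines_in \<pi>. w \<in> l} = covers (vec.span {w}) \<pi>"
    using assms(3) by (auto simp: lines_in_def covers_def proj_subspace_def
        intro: vec.span_base subsetD[OF vec.span_minimal[of "{w}"]])
  moreover have "vec.span {w} \<subseteq> \<pi>"
    using assms sub by (intro vec.span_minimal) auto
  ultimately show ?thesis
    using sub assms(3) by (simp add: card_covers eval_nat_numeral)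
qed

lemma card_nonzero:
  fixes U :: "(('a::{field,finite}) ^ 'n) set"
  assumes "vec.subspace U"
  shows "int (card (U - {0})) = int CARD('a) ^ vec.dim U - 1"
proof -
  have "0 \<in> U" using assms by (rule vec.subspace_0)
  then have "card U = Suc (card (U - {0}))"
    using card_Suc_Diff1[of U 0] by simp
  with card_subspace[OF assms] show ?thesis
    by (metis add_diff_cancel_left' of_nat_Suc of_nat_power)
qed

text \<open>Double counting of incident pairs of a vector of \<open>W\<close> and a line. The zero
  vector must be excluded, as it lies on every line.\<close>

lemma sum_lines_in_plane:
  fixes \<pi> :: "(('a::{field,finite}) ^ 'n) set"
  assumes "pg_plane \<pi>" "0 \<notin> W"
  shows "(\<Sum>l \<in> lines_in \<pi>. card (W \<inter> l)) = card (W \<inter> \<pi>) * (CARD('a) + 1)"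
proof -
  have "(\<Sum>l \<in> lines_in \<pi>. card {w \<in> W \<inter> \<pi>. w \<in> l}) = (\<Sum>w \<in> W \<inter> \<pi>. CARD('a) + 1)"
  proof (rule sum_multicount_gen)
    show "\<forall>w \<in> W \<inter> \<pi>. card {l \<in> lines_in \<pi>. w \<in> l} = CARD('a) + 1"
      using assms by (intro ballI card_lines_through_point) auto
  qed auto
  moreover have "{w \<in> W \<inter> \<pi>. w \<in> l} = W \<inter> l" if "l \<in> lines_in \<pi>" for l
    using that by (auto simp: lines_in_def)
  ultimately show ?thesis by simp
qed

lemma card_lines_in_plane:
  fixes \<pi> :: "(('a::{field,finite}) ^ 'n) set"
  assumes "pg_plane \<pi>"
  shows "card (lines_in \<pi>) = CARD('a) ^ 2 + CARD('a) + 1"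
proof -
  let ?q = "int CARD('a)"
  have nonzero: "(UNIV - {0}) \<inter> U = U - {0}" for U :: "('a ^ 'n) set"
    by blast
  have "int (\<Sum>l \<in> lines_in \<pi>. card ((UNIV - {0}) \<inter> l)) = (\<Sum>l \<in> lines_in \<pi>. ?q ^ 2 - 1)"
    unfolding of_nat_sum
    by (intro sum.cong) (auto simp: lines_in_def proj_subspace_def nonzero card_nonzero power2_eq_square)
  moreover have "int (card ((UNIV - {0}) \<inter> \<pi>)) = ?q ^ 3 - 1"
    using assms by (simp add: proj_subspace_def nonzero card_nonzero)
  ultimately have "int (card (lines_in \<pi>)) * (?q ^ 2 - 1) = (?q ^ 3 - 1) * (?q + 1)"
    using sum_lines_in_plane[OF assms, of "UNIV - {0}"] by (simp add: algebra_simps)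
  also have "\<dots> = (?q ^ 2 + ?q + 1) * (?q ^ 2 - 1)"
    by (simp add: algebra_simps eval_nat_numeral)
  finally have "int (card (lines_in \<pi>)) = ?q ^ 2 + ?q + 1"
    using card_field_ge_2[where 'a = 'a] by (simp add: power2_eq_1_iff)
  then show ?thesis
    by (metis of_nat_1 of_nat_add of_nat_eq_iff of_nat_power)
qed

lemma dim_Int_less:
  assumes "proj_subspace k U" "proj_subspace k V" "U \<noteq> V"
  shows "vec.dim (U \<inter> V) \<le> k"
proof (rule ccontr)
  assume "\<not> vec.dim (U \<inter> V) \<le> k"
  then have "U \<inter> V = U" "U \<inter> V = V"
    using assms by (intro vec.subspace_dim_equal; simp add: proj_subspace_def vec.subspace_inter)+
  with assms(3) show False by simp
qed

text \<open>This turns the relation of meeting in a line into a number that can be summed. Distinct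
  planes meet in dimension at most 2, so a line in the meet is the whole meet.\<close>

lemma lines_in_plane_Int:
  assumes "pg_plane \<pi>" "pg_plane \<sigma>" "\<pi> \<noteq> \<sigma>"
  shows "card (lines_in (\<pi> \<inter> \<sigma>)) = (if pg_line (\<pi> \<inter> \<sigma>) then 1 else 0)"
proof -
  have sub: "vec.subspace (\<pi> \<inter> \<sigma>)" and dim: "vec.dim (\<pi> \<inter> \<sigma>) \<le> 2"
    using assms dim_Int_less[OF assms] by (auto simp: proj_subspace_def intro: vec.subspace_inter)
  have eq: "l = \<pi> \<inter> \<sigma>" if "l \<in> lines_in (\<pi> \<inter> \<sigma>)" for l
    using that sub dim by (intro vec.subspace_dim_equal) (auto simp: lines_in_def proj_subspace_def)
  show ?thesis
  proof (cases "pg_line (\<pi> \<inter> \<sigma>)")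
    case True
    then have "lines_in (\<pi> \<inter> \<sigma>) = {\<pi> \<inter> \<sigma>}" using eq by (auto simp: lines_in_def)
    with True show ?thesis by simp
  next
    case False
    then have "lines_in (\<pi> \<inter> \<sigma>) = {}" using eq by (auto simp: lines_in_def)
    with False show ?thesis by simp
  qed
qed

lemma lines_in_plane_unique:
  assumes "pg_plane \<pi>" "pg_plane \<sigma>" "pg_line l" "pg_line l'" "l \<noteq> l'"
    and "l \<subseteq> \<pi>" "l' \<subseteq> \<pi>" "l \<subseteq> \<sigma>" "l' \<subseteq> \<sigma>"
  shows "\<pi> = \<sigma>"
proof (rule ccontr)
  assume "\<pi> \<noteq> \<sigma>"
  then have "card (lines_in (\<pi> \<inter> \<sigma>)) \<le> 1"
    using lines_in_plane_Int[OF assms(1,2)] by simp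
  moreover have "vec.subspace (\<pi> \<inter> \<sigma>)" "vec.dim (\<pi> \<inter> \<sigma>) \<le> 2"
    using assms dim_Int_less[OF assms(1,2) \<open>\<pi> \<noteq> \<sigma>\<close>]
    by (auto simp: proj_subspace_def intro: vec.subspace_inter)
  then have "l = \<pi> \<inter> \<sigma>" "l' = \<pi> \<inter> \<sigma>"
    using assms by (intro vec.subspace_dim_equal; simp add: proj_subspace_def)+
  ultimately show False using assms by simp
qed

lemma meeting_lines_span_plane:
  assumes "pg_line l" "pg_line l'" "l \<noteq> l'" "w \<in> l" "w \<in> l'" "w \<noteq> 0"
  obtains \<pi> where "pg_plane \<pi>" "l \<subseteq> \<pi>" "l' \<subseteq> \<pi>"
proof -
  let ?U = "{x + y |x y. x \<in> l \<and> y \<in> l'}"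
  have l: "vec.subspace l" "vec.subspace l'" "vec.dim l = 2" "vec.dim l' = 2"
    using assms by (auto simp: proj_subspace_def)
  have "vec.dim (l \<inter> l') \<le> 1"
    using dim_Int_less assms by blast
  \<comment> \<open>The common nonzero vector \<open>w\<close> makes the meet exactly a point, so
    the sum has dimension 2 + 2 - 1.\<close>
  moreover have "vec.dim (l \<inter> l') \<noteq> 0"
    using assms by auto
  ultimately have "vec.dim ?U = 3"
    using vec.dim_sums_Int[OF l(1,2)] l by linarith
  then have "pg_plane ?U"
    using l vec.subspace_sums[OF l(1,2)] by (simp add: proj_subspace_def)
  moreover have "l \<subseteq> ?U"
    using vec.subspace_0[OF l(2)] by force
  moreover have "l' \<subseteq> ?U"
    using vec.subspace_0[OF l(1)] by force
  ultimately show ?thesis by (rule that)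
qed

text \<open>The sum of the two lines stays in dimension 3, so by the dimension formula they meet in
  a point, which has \<open>q - 1\<close> nonzero vectors.\<close>

lemma card_meet_lines_in_plane:
  fixes \<pi> :: "(('a::{field,finite}) ^ 'n) set"
  assumes "pg_plane \<pi>" "l \<in> lines_in \<pi>" "l' \<in> lines_in \<pi>" "l \<noteq> l'"
  shows "int (card (l \<inter> l' - {0})) = int CARD('a) - 1"
proof -
  let ?U = "{x + y |x y. x \<in> l \<and> y \<in> l'}"
  have \<pi>: "vec.subspace \<pi>" "vec.dim \<pi> = 3"
    using assms by (auto simp: proj_subspace_def)
  have l: "vec.subspace l" "vec.subspace l'" "vec.dim l = 2" "vec.dim l' = 2"
    using assms by (auto simp: lines_in_def proj_subspace_def)
  have "?U \<subseteq> \<pi>"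
    using assms by (auto simp: lines_in_def intro!: vec.subspace_add[OF \<pi>(1)])
  then have "vec.dim ?U \<le> 3"
    unfolding \<pi>(2)[symmetric] by (rule vec.dim_subset)
  moreover have "vec.dim (l \<inter> l') \<le> 1"
    using assms dim_Int_less[of 1 l l'] by (auto simp: lines_in_def)
  ultimately have "vec.dim (l \<inter> l') = 1"
    using vec.dim_sums_Int[OF l(1,2)] l by linarith
  then show ?thesis
    using card_nonzero[OF vec.subspace_inter[OF l(1,2)]] by simp
qed

section \<open>Summing the planes of \<open>L\<close> over the lines of a plane\<close>

definition planes_on :: "(('a::field) ^ 'n) set set \<Rightarrow> ('a ^ 'n) set \<Rightarrow> ('a ^ 'n) set set" where
  "planes_on L l = {\<sigma> \<in> L. l \<subseteq> \<sigma>}"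

text \<open>Count pairs of a line and a plane \<sigma> of \<open>L\<close> with the line in
  \<open>\<pi> \<inter> \<sigma>\<close>. A plane \<open>\<sigma> \<noteq> \<pi>\<close> contributes
  1 exactly if it meets \<pi> in a line; \<pi> itself, if in \<open>L\<close>, contributes all its
  lines.\<close>

lemma sum_card_planes_on:
  fixes \<pi> :: "(('a::{field,finite}) ^ 'n) set"
  assumes L: "\<And>\<sigma>. \<sigma> \<in> L \<Longrightarrow> pg_plane \<sigma>" and \<pi>: "pg_plane \<pi>"
  shows "(\<Sum>l \<in> lines_in \<pi>. card (planes_on L l)) =
    card {\<sigma> \<in> L. \<sigma> \<noteq> \<pi> \<and> pg_line (\<pi> \<inter> \<sigma>)} +
    (if \<pi> \<in> L then CARD('a) ^ 2 + CARD('a) + 1 else 0)"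
proof -
  let ?k = "\<lambda>\<sigma>. card (lines_in (\<pi> \<inter> \<sigma>))"
  have "{l \<in> lines_in \<pi>. l \<subseteq> \<sigma>} = lines_in (\<pi> \<inter> \<sigma>)" for \<sigma>
    by (auto simp: lines_in_def)
  then have "(\<Sum>l \<in> lines_in \<pi>. card (planes_on L l)) = (\<Sum>\<sigma>\<in>L. ?k \<sigma>)"
    unfolding planes_on_def by (intro sum_multicount_gen) auto
  also have "\<dots> = (\<Sum>\<sigma> \<in> L - {\<pi>}. ?k \<sigma>) + (\<Sum>\<sigma> \<in> L \<inter> {\<pi>}. ?k \<sigma>)"
    by (subst add.commute, rule sum.Int_Diff) simp
  also have "(\<Sum>\<sigma> \<in> L - {\<pi>}. ?k \<sigma>) = (\<Sum>\<sigma> \<in> L - {\<pi>}. if pg_line (\<pi> \<inter> \<sigma>) then 1 else 0)"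
    using L \<pi> by (intro sum.cong lines_in_plane_Int) auto
  also have "\<dots> = card {\<sigma> \<in> L. \<sigma> \<noteq> \<pi> \<and> pg_line (\<pi> \<inter> \<sigma>)}"
    by (simp add: sum.If_cases) (rule arg_cong[of _ _ card], auto)
  also have "(\<Sum>\<sigma> \<in> L \<inter> {\<pi>}. ?k \<sigma>) = (if \<pi> \<in> L then CARD('a) ^ 2 + CARD('a) + 1 else 0)"
    using card_lines_in_plane[OF \<pi>] by simp
  finally show ?thesis .
qed

lemma card_planes_through_line:
  fixes l :: "(('a::{field,finite}) ^ 'n) set"
  assumes "pg_line l"
  shows "card (covers l UNIV) = (\<Sum>i<CARD('n) - 2. CARD('a) ^ i)"
  using assms card_covers[of l UNIV]
  by (simp add: proj_subspace_def vec_dim_card numeral_2_eq_2 del: vec.dim_UNIV)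

lemma covers_line: "pg_line l \<Longrightarrow> covers l UNIV = {\<pi>. pg_plane \<pi> \<and> l \<subseteq> \<pi>}"
  by (auto simp: covers_def proj_subspace_def)

text \<open>The hypotheses of the theorem in summed form, in the case that \<open>x\<close> does not
  exceed the bound. In \<open>sum_in\<close> the term \<open>q ^ 2 + q + 1\<close> that \<pi>
  contributes cancels against the one in
  \<open>lambda2 = N - (q ^ 2 + q + 1) - q - 1\<close>.\<close>

locale plane_system =
  fixes L :: "(('a::{field,finite}) ^ 'n) set set" and x q N :: int
  assumes q: "q = int CARD('a)" and N: "N = (\<Sum>i<CARD('n) - 2. q ^ i)"
    and dim: "CARD('n) \<ge> 10"
    and planes: "\<pi> \<in> L \<Longrightarrow> pg_plane \<pi>"
    and x_pos: "x > 0" and x_le: "x \<le> (q + 1) * (q ^ 2 + q + 1)"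
    and sum_out: "\<lbrakk>pg_plane \<pi>; \<pi> \<notin> L\<rbrakk> \<Longrightarrow>
      (\<Sum>l \<in> lines_in \<pi>. int (card (planes_on L l))) = x"
    and sum_in: "\<pi> \<in> L \<Longrightarrow>
      (\<Sum>l \<in> lines_in \<pi>. int (card (planes_on L l))) = x + N - q - 1"
begin

abbreviation m :: "('a ^ 'n) set \<Rightarrow> int" where
  "m l \<equiv> int (card (planes_on L l))"

text \<open>\<open>S\<close> consists of the full lines, and \<open>W\<close> of the nonzero vectors on them: vectors are counted in
  place of points, so a projective count is multiplied by \<open>q - 1\<close>.\<close>

definition S :: "('a ^ 'n) set set" where
  "S = {l. pg_line l \<and> (\<forall>\<pi>. pg_plane \<pi> \<and> l \<subseteq> \<pi> \<longrightarrow> \<pi> \<in> L)}"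

definition W :: "('a ^ 'n) set" where
  "W = \<Union>S - {0}"

lemma S_line: "l \<in> S \<Longrightarrow> pg_line l"
  and S_plane: "\<lbrakk>l \<in> S; pg_plane \<pi>; l \<subseteq> \<pi>\<rbrakk> \<Longrightarrow> \<pi> \<in> L"
  by (auto simp: S_def)

lemma q_ge_2: "q \<ge> 2"
  unfolding q using card_field_ge_2[where 'a = 'a] by simp

text \<open>The bound on \<open>x\<close> makes the right side a polynomial of degree 5 in
  \<open>q\<close>, while \<open>dim\<close> gives \<open>N\<close> all powers up to
  \<open>q ^ 7\<close>. The inequality is what excludes a plane of \<open>L\<close> with no full
  line.\<close>

lemma N_gt: "N > (q + 1) + (q ^ 2 + q) * x"
proof -
  have "(q ^ 2 + q) * x \<le> (q ^ 2 + q) * ((q + 1) * (q ^ 2 + q + 1))"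
    using x_le q_ge_2 by (intro mult_left_mono) auto
  also have "\<dots> = q ^ 5 + 3 * q ^ 4 + 4 * q ^ 3 + 3 * q ^ 2 + q"
    by (simp add: algebra_simps eval_nat_numeral)
  finally have le: "(q ^ 2 + q) * x \<le> \<dots>" .
  have "(\<Sum>i<8. q ^ i) \<le> N"
    unfolding N using dim q_ge_2 by (intro sum_mono2) auto
  then have ge: "1 + q + q ^ 2 + q ^ 3 + q ^ 4 + q ^ 5 + q ^ 6 + q ^ 7 \<le> N"
    by (simp add: eval_nat_numeral add_ac)
  \<comment> \<open>With \<open>q \<ge> 2\<close>, these doublings let \<open>q ^ 6\<close> and
    \<open>q ^ 7\<close> absorb the coefficients 3, 4 and 3.\<close>
  have step: "2 * q ^ k \<le> q ^ Suc k" for k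
    using q_ge_2 by simp
  have "2 * q \<le> q ^ 2" "2 * q ^ 2 \<le> q ^ 3" "2 * q ^ 3 \<le> q ^ 4" "2 * q ^ 4 \<le> q ^ 5"
    "2 * q ^ 5 \<le> q ^ 6" "2 * q ^ 6 \<le> q ^ 7"
    using step[of 1] step[of 2] step[of 3] step[of 4] step[of 5] step[of 6]
    by (simp_all only: eval_nat_numeral power_Suc0_right One_nat_def BitM.simps)
  then show ?thesis
    using le ge q_ge_2 by linarith
qed

lemma x_less_N: "x + q + 1 < N"
proof -
  have "1 * x \<le> (q ^ 2 + q) * x"
    using q_ge_2 x_pos by (intro mult_right_mono) (auto intro: add_increasing)
  with N_gt show ?thesis by simp
qed

section \<open>Full lines and their position in the planes of \<open>L\<close>\<close>

lemma mem_S_if_gt: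
  assumes "pg_line l" "m l > x"
  shows "l \<in> S"
proof (rule ccontr)
  assume "l \<notin> S"
  then obtain \<pi> where \<pi>: "pg_plane \<pi>" "l \<subseteq> \<pi>" "\<pi> \<notin> L"
    using assms by (auto simp: S_def)
  \<comment> \<open>The line \<open>l\<close> is one of the lines of \<pi>, and \<pi> lies outside
    \<open>L\<close>, so the sum is only \<open>x\<close>.\<close>
  then have "m l \<le> (\<Sum>l \<in> lines_in \<pi>. m l)"
    using assms by (intro member_le_sum) (auto simp: lines_in_def)
  with \<pi> sum_out assms show False by simp
qed

lemma m_S:
  assumes "l \<in> S"
  shows "m l = N"
proof -
  have "planes_on L l = covers l UNIV"
    using assms planes by (auto simp: covers_line S_def planes_on_def)
  then show ?thesis
    using card_planes_through_line[OF S_line[OF assms]] by (simp add: N q)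
qed

lemma S_in_plane:
  assumes "\<pi> \<in> L"
  obtains l where "l \<in> S" "l \<in> lines_in \<pi>"
proof (rule ccontr)
  assume "\<not> thesis"
  then have "l \<notin> S" if "l \<in> lines_in \<pi>" for l
    using that \<open>\<And>l. \<lbrakk>l \<in> S; l \<in> lines_in \<pi>\<rbrakk> \<Longrightarrow> thesis\<close> by blast
  then have "m l \<le> x" if "l \<in> lines_in \<pi>" for l
    using that mem_S_if_gt by (fastforce simp: lines_in_def)
  then have "(\<Sum>l \<in> lines_in \<pi>. m l) \<le> of_nat (card (lines_in \<pi>)) * x"
    by (rule sum_bounded_above)
  then have "x + N - q - 1 \<le> (q ^ 2 + q + 1) * x"
    using sum_in[OF assms] card_lines_in_plane[OF planes[OF assms]]
    by (simp add: q add_ac)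
  with N_gt show False by (simp add: algebra_simps)
qed

text \<open>Two full lines would already contribute \<open>2 * N\<close>, more than the total
  \<open>x + N - q - 1\<close>, since \<open>x < N\<close>.\<close>

lemma S_in_plane_unique:
  assumes "\<pi> \<in> L" "l \<in> S" "l' \<in> S" "l \<in> lines_in \<pi>" "l' \<in> lines_in \<pi>"
  shows "l = l'"
proof (rule ccontr)
  assume "l \<noteq> l'"
  then have "m l + m l' = (\<Sum>l \<in> {l, l'}. m l)"
    by simp
  also have "\<dots> \<le> (\<Sum>l \<in> lines_in \<pi>. m l)"
    using assms by (intro sum_mono2) auto
  finally show False
    using sum_in[OF assms(1)] m_S[OF assms(2)] m_S[OF assms(3)] x_less_N q_ge_2 by simp
qed

text \<open>Two full lines with a common point would span a plane, which is in \<open>L\<close> by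
  fullness and would contain both.\<close>

lemma S_disjoint:
  assumes "l \<in> S" "l' \<in> S" "w \<in> l" "w \<in> l'" "w \<noteq> 0"
  shows "l = l'"
proof (rule ccontr)
  assume "l \<noteq> l'"
  then obtain \<pi> where "pg_plane \<pi>" "l \<subseteq> \<pi>" "l' \<subseteq> \<pi>"
    using assms meeting_lines_span_plane S_line by metis
  moreover from this have "\<pi> \<in> L" using assms S_plane by blast
  moreover have "pg_line l" "pg_line l'" using assms S_line by blast+
  ultimately show False
    using S_in_plane_unique[of \<pi> l l'] assms \<open>l \<noteq> l'\<close> unfolding lines_in_def by blast
qed

section \<open>Counting points on full lines\<close>

lemma card_W_S:
  assumes "l \<in> S"
  shows "int (card (W \<inter> l)) = q ^ 2 - 1"
proof -
  have "W \<inter> l = l - {0}" using assms by (auto simp: W_def)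
  then show ?thesis
    using S_line[OF assms] card_nonzero[of l] by (simp add: proj_subspace_def q power2_eq_square)
qed

text \<open>A plane of \<open>L\<close> on \<open>l\<close> contains one line of \<open>S\<close>, which meets \<open>l\<close> in one point; conversely
  a point of \<open>l\<close> on a line of \<open>S\<close> determines the plane of \<open>L\<close> spanned by the two lines.\<close>

lemma card_W_line:
  assumes l: "pg_line l" "l \<notin> S"
  shows "int (card (W \<inter> l)) = (q - 1) * m l"
proof -
  obtain f where f: "f \<sigma> \<in> S" "f \<sigma> \<in> lines_in \<sigma>" if "\<sigma> \<in> L" for \<sigma>
  proof -
    have "\<forall>\<sigma>\<in>L. \<exists>l. l \<in> S \<and> l \<in> lines_in \<sigma>" using S_in_plane by blast
    then show ?thesis using that by metis
  qed
  have union: "W \<inter> l = (\<Union>\<sigma> \<in> planes_on L l. f \<sigma> \<inter> l - {0})"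
  proof (intro equalityI subsetI)
    fix w assume "w \<in> W \<inter> l"
    then obtain s where s: "s \<in> S" "w \<in> s" "w \<in> l" "w \<noteq> 0"
      by (auto simp: W_def)
    then obtain \<sigma> where \<sigma>: "pg_plane \<sigma>" "s \<subseteq> \<sigma>" "l \<subseteq> \<sigma>"
      using l meeting_lines_span_plane S_line by metis
    then have "\<sigma> \<in> L" using s S_plane by metis
    with s \<sigma> have "s = f \<sigma>"
      by (intro S_in_plane_unique[of \<sigma>] f) (auto simp: lines_in_def dest: S_line)
    then show "w \<in> (\<Union>\<sigma> \<in> planes_on L l. f \<sigma> \<inter> l - {0})"
      using s \<sigma> \<open>\<sigma> \<in> L\<close> by (auto simp: planes_on_def)
  qed (use f in \<open>auto simp: W_def planes_on_def\<close>)
  \<comment> \<open>The union is disjoint: a common nonzero vector forces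
    \<open>f \<sigma> = f \<tau>\<close>, and this line together with \<open>l\<close> determines
    the plane.\<close>
  have "\<sigma> = \<tau>" if "\<sigma> \<in> planes_on L l" "\<tau> \<in> planes_on L l"
    "w \<in> f \<sigma>" "w \<in> f \<tau>" "w \<noteq> 0" for \<sigma> \<tau> w
  proof -
    have \<sigma>: "\<sigma> \<in> L" "\<tau> \<in> L" "l \<subseteq> \<sigma>" "l \<subseteq> \<tau>"
      using that by (auto simp: planes_on_def)
    have "f \<sigma> = f \<tau>"
      using S_disjoint that f \<sigma> by metis
    then have "f \<sigma> \<subseteq> \<sigma>" "f \<sigma> \<subseteq> \<tau>" "pg_line (f \<sigma>)" "f \<sigma> \<noteq> l"
      using f \<sigma> l by (auto simp: lines_in_def)
    then show ?thesis
      using lines_in_plane_unique[of \<sigma> \<tau> "f \<sigma>" l] \<sigma> l planes by auto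
  qed
  then have "card (W \<inter> l) = (\<Sum>\<sigma> \<in> planes_on L l. card (f \<sigma> \<inter> l - {0}))"
    unfolding union by (intro card_UN_disjoint) auto
  also have "int \<dots> = (\<Sum>\<sigma> \<in> planes_on L l. q - 1)"
    unfolding of_nat_sum q
    using f l planes by (intro sum.cong refl card_meet_lines_in_plane)
      (auto simp: planes_on_def lines_in_def)
  finally show ?thesis by simp
qed

text \<open>Both cases give the same value: in a plane of \<open>L\<close>, the single full line
  contributes \<open>q ^ 2 - 1\<close> instead of \<open>(q - 1) * N\<close>, and this cancels the
  excess \<open>N - q - 1\<close> of \<open>sum_in\<close> over \<open>sum_out\<close>.\<close>

lemma card_W_plane:
  assumes "pg_plane \<pi>"
  shows "int (card (W \<inter> \<pi>)) * (q + 1) = (q - 1) * x"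
proof -
  have "int (card (W \<inter> \<pi>)) * (q + 1) = (\<Sum>l \<in> lines_in \<pi>. int (card (W \<inter> l)))"
    using sum_lines_in_plane[OF assms, of W] unfolding q of_nat_sum[symmetric]
    by (simp add: W_def distrib_left)
  also have "\<dots> = (q - 1) * x"
  proof (cases "\<pi> \<in> L")
    case False
    then have "l \<notin> S" if "l \<in> lines_in \<pi>" for l
      using that assms S_plane by (auto simp: lines_in_def)
    then have "(\<Sum>l \<in> lines_in \<pi>. int (card (W \<inter> l))) = (\<Sum>l \<in> lines_in \<pi>. (q - 1) * m l)"
      using card_W_line by (intro sum.cong) (auto simp: lines_in_def)
    with sum_out[OF assms False] show ?thesis
      by (simp flip: sum_distrib_left)
  next
    case True
    then obtain s where s: "s \<in> S" "s \<in> lines_in \<pi>"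
      using S_in_plane by blast
    have "l \<notin> S" if "l \<in> lines_in \<pi> - {s}" for l
      using that s True S_in_plane_unique by auto
    then have "(\<Sum>l \<in> lines_in \<pi> - {s}. int (card (W \<inter> l))) =
        (\<Sum>l \<in> lines_in \<pi> - {s}. (q - 1) * m l)"
      using card_W_line by (intro sum.cong) (auto simp: lines_in_def)
    also have "\<dots> = (q - 1) * ((\<Sum>l \<in> lines_in \<pi>. m l) - N)"
      using s by (simp add: sum.remove[of _ s] m_S flip: sum_distrib_left)
    finally show ?thesis
      using s card_W_S[of s] sum_in[OF True]
      by (simp add: sum.remove[of _ s] algebra_simps power2_eq_square)
  qed
  finally show ?thesis .
qed

section \<open>The full lines cover all points\<close>

lemma S_nonempty: "S \<noteq> {}"
proof -
  obtain B :: "('a ^ 'n) set" where B: "vec.independent B" "card B = CARD('n)"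
    using vec.basis_exists[of UNIV] vec_dim_card by metis
  then obtain T where T: "T \<subseteq> B" "card T = 3"
    using dim obtain_subset_with_card_n[of 3 B] by auto
  then have "vec.independent T"
    using B vec.independent_mono by blast
  then have \<pi>: "pg_plane (vec.span T)"
    using T by (simp add: proj_subspace_def vec.dim_eq_card_independent)
  \<comment> \<open>With \<open>L\<close> empty, the sum over the lines of this plane would be 0,
    but \<open>x > 0\<close>.\<close>
  have "L \<noteq> {}"
    using sum_out[OF \<pi>] x_pos by (auto simp: planes_on_def)
  then show ?thesis using S_in_plane by blast
qed

text \<open>The planes on \<open>l\<close> partition the vectors off \<open>l\<close>. The total is
  thus an affine function of \<open>card (W \<inter> l)\<close> with slope \<open>1 - N\<close>,
  which lets lines be compared.\<close>

lemma card_W_split: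
  assumes l: "pg_line l" and C: "\<And>\<pi>. pg_plane \<pi> \<Longrightarrow> int (card (W \<inter> \<pi>)) = C"
  shows "int (card W) = int (card (W \<inter> l)) + N * (C - int (card (W \<inter> l)))"
proof -
  have sub: "vec.subspace l" using l by (simp add: proj_subspace_def)
  have diff: "int (card (W \<inter> U - l)) = int (card (W \<inter> U)) - int (card (W \<inter> l))" if "l \<subseteq> U" for U
  proof -
    have "card (W \<inter> U) = card (W \<inter> l) + card (W \<inter> U - l)"
      using that by (subst card_Un_disjoint[symmetric]) (auto intro: arg_cong[of _ _ card])
    then show ?thesis by simp
  qed
  have "int (card (W \<inter> UNIV - l)) = (\<Sum>\<pi> \<in> covers l UNIV. int (card (W \<inter> \<pi> - l)))"
    using sum_card_covers[OF sub, of UNIV W] by (simp flip: of_nat_sum)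
  also have "\<dots> = (\<Sum>\<pi> \<in> covers l UNIV. C - int (card (W \<inter> l)))"
    using l C by (intro sum.cong) (auto simp: covers_line diff)
  also have "\<dots> = N * (C - int (card (W \<inter> l)))"
    using card_planes_through_line[OF l] by (simp add: N q)
  finally show ?thesis using diff[of UNIV] by simp
qed

lemma W_eq: "W = UNIV - {0}"
proof -
  obtain s where s: "s \<in> S" using S_nonempty by blast
  obtain C where C: "int (card (W \<inter> \<pi>)) = C" if "pg_plane \<pi>" for \<pi>
  proof
    fix \<pi> :: "('a ^ 'n) set" assume "pg_plane \<pi>"
    \<comment> \<open>The division is exact by \<open>card_W_plane\<close>.\<close>
    then show "int (card (W \<inter> \<pi>)) = (q - 1) * x div (q + 1)"
      unfolding card_W_plane[OF \<open>pg_plane \<pi>\<close>, symmetric] using q_ge_2 by simp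
  qed
  have line: "int (card (W \<inter> l)) = q ^ 2 - 1" if l: "pg_line l" for l
  proof -
    \<comment> \<open>Compare the two expressions for \<open>card W\<close> obtained from
      \<open>l\<close> and from the full line \<open>s\<close>.\<close>
    have "(N - 1) * (int (card (W \<inter> l)) - (q ^ 2 - 1)) = 0"
      using card_W_split[OF l C] card_W_split[OF S_line[OF s] C] card_W_S[OF s]
      by (simp add: algebra_simps)
    moreover have "N - 1 \<noteq> 0" using x_less_N x_pos q_ge_2 by simp
    ultimately show ?thesis by simp
  qed
  have "w \<in> W" if "w \<noteq> 0" for w
  proof -
    \<comment> \<open>A vector \<open>u\<close> outside the span of \<open>w\<close> gives a line
      through \<open>w\<close>; all nonzero vectors of that line are in \<open>W\<close> by
      cardinality.\<close>
    have "vec.dim {w} < vec.dim (UNIV :: ('a ^ 'n) set)"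
      using dim that by (simp add: vec_dim_card del: vec.dim_UNIV)
    then have "vec.span {w} \<noteq> UNIV"
      by (metis nat_less_le vec.dim_span)
    then obtain u where "u \<notin> vec.span {w}" by blast
    then have l: "pg_line (vec.span {u, w})"
      using that by (simp add: proj_subspace_def vec.dim_insert)
    have "W \<inter> vec.span {u, w} = vec.span {u, w} - {0}"
    proof (rule card_subset_eq)
      show "card (W \<inter> vec.span {u, w}) = card (vec.span {u, w} - {0})"
        using line[OF l] card_nonzero[of "vec.span {u, w}"] l
        by (simp add: proj_subspace_def q power2_eq_square)
    qed (auto simp: W_def)
    then show ?thesis using that vec.span_base[of w "{u, w}"] by blast
  qed
  then show ?thesis by (auto simp: W_def)
qed

text \<open>As every nonzero vector is in \<open>W\<close>, the plane count becomes
  \<open>(q ^ 3 - 1) * (q + 1) = (q - 1) * x\<close>.\<close>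

lemma x_eq: "x = (q + 1) * (q ^ 2 + q + 1)"
proof -
  obtain s where s: "s \<in> S" using S_nonempty by blast
  have "planes_on L s \<noteq> {}"
    using m_S[OF s] x_less_N x_pos q_ge_2 by force
  then obtain \<pi> where "\<pi> \<in> L" by (auto simp: planes_on_def)
  then have \<pi>: "pg_plane \<pi>" by (rule planes)
  have "W \<inter> \<pi> = \<pi> - {0}" using W_eq by auto
  then have "int (card (W \<inter> \<pi>)) = q ^ 3 - 1"
    using \<pi> card_nonzero[of \<pi>] by (simp add: proj_subspace_def q)
  with card_W_plane[OF \<pi>] have "(q - 1) * x = (q - 1) * ((q + 1) * (q ^ 2 + q + 1))"
    by (simp add: algebra_simps eval_nat_numeral)
  then show ?thesis using q_ge_2 by simp
qed

text \<open>\<open>W_eq\<close> gives covering and \<open>S_disjoint\<close> gives disjointness;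
  writing points as spans of nonzero vectors transfers both from vectors to points.\<close>

lemma line_spread_S: "line_spread S"
  unfolding line_spread_def
proof (intro conjI ballI partition_onI)
  show "pg_line l" if "l \<in> S" for l
    using that by (rule S_line)
  have point: "\<exists>w. w \<noteq> 0 \<and> p = vec.span {w}" if "pg_point p" for p :: "('a ^ 'n) set"
  proof -
    have p: "vec.subspace p" "vec.dim p = 1"
      using that by (auto simp: proj_subspace_def)
    then have "\<not> p \<subseteq> {0}"
      by (metis vec.dim_eq_0 zero_neq_one)
    then obtain w where w: "w \<in> p" "w \<noteq> 0" by auto
    then have "vec.span {w} = p"
      using p by (intro vec.subspace_dim_equal vec.span_minimal) auto
    with w show ?thesis by auto
  qed
  show "\<Union>(points_on ` S) = {p. pg_point p}"
  proof (intro equalityI subsetI)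
    fix p :: "('a ^ 'n) set" assume p: "p \<in> {p. pg_point p}"
    then obtain w where w: "w \<noteq> 0" "p = vec.span {w}" using point by auto
    then obtain l where l: "l \<in> S" "w \<in> l" using W_eq by (auto simp: W_def)
    then have "p \<subseteq> l"
      unfolding w using S_line by (intro vec.span_minimal) (auto simp: proj_subspace_def)
    with p l show "p \<in> \<Union>(points_on ` S)" by (auto simp: points_on_def)
  qed (auto simp: points_on_def)
  show "disjnt P Q" if PQ: "P \<in> points_on ` S" "Q \<in> points_on ` S" "P \<noteq> Q" for P Q
  proof -
    obtain l l' where l: "l \<in> S" "l' \<in> S" "P = points_on l" "Q = points_on l'" "l \<noteq> l'"
      using PQ by auto
    have False if "pg_point p" "p \<subseteq> l" "p \<subseteq> l'" for p
    proof -
      obtain w where "w \<noteq> 0" "p = vec.span {w}" using point \<open>pg_point p\<close> by blast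
      then have "w \<in> l" "w \<in> l'" using that vec.span_base[of w "{w}"] by auto
      with S_disjoint l \<open>w \<noteq> 0\<close> show False by blast
    qed
    then show ?thesis using l by (auto simp: disjnt_def points_on_def)
  qed
  have "P \<noteq> {}" if P: "P \<in> points_on ` S" for P
  proof -
    obtain l where l: "l \<in> S" "P = points_on l" using P by auto
    then have sub: "vec.subspace l" "vec.dim l = 2"
      using S_line by (auto simp: proj_subspace_def)
    then have "\<not> l \<subseteq> {0}"
      by (metis vec.dim_eq_0 zero_neq_numeral)
    then obtain w where w: "w \<in> l" "w \<noteq> 0" by auto
    then have "vec.span {w} \<in> P"
      using l sub by (auto simp: points_on_def proj_subspace_def intro: subsetD[OF vec.span_minimal])
    then show ?thesis by blast
  qed
  then show "{} \<notin> points_on ` S" by blast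
qed

lemma L_eq: "L = {\<pi>. pg_plane \<pi> \<and> (\<exists>l\<in>S. l \<subseteq> \<pi>)}"
proof (intro equalityI subsetI)
  fix \<pi> assume "\<pi> \<in> L"
  moreover from this obtain l where "l \<in> S" "l \<in> lines_in \<pi>" by (rule S_in_plane)
  ultimately show "\<pi> \<in> {\<pi>. pg_plane \<pi> \<and> (\<exists>l\<in>S. l \<subseteq> \<pi>)}"
    using planes by (auto simp: lines_in_def)
qed (use S_plane in blast)

end

theorem theorem3p6:
  fixes \<L> :: "(('a::{field,finite}) ^ 'n) set set"
    and q n :: nat and x :: int and lambda2 :: real
  assumes "q = CARD('a)" and "CARD('n) = n + 1"
    and "n \<ge> 9" and "odd n"
    and "lambda2 = (real q ^ (n - 1) - real q ^ 3) / (real q - 1) - real q - 1"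
    and "\<forall>\<pi>\<in>\<L>. pg_plane \<pi>"
    and "x > 0"
    and "\<forall>\<pi>. pg_plane \<pi> \<and> \<pi> \<notin> \<L> \<longrightarrow>
           int (card {\<sigma>\<in>\<L>. pg_line (\<pi> \<inter> \<sigma>)}) = x"
    and "\<forall>\<pi>\<in>\<L>.
           real (card {\<sigma>\<in>\<L>. \<sigma> \<noteq> \<pi> \<and> pg_line (\<pi> \<inter> \<sigma>)}) = lambda2 + of_int x"
  shows "x \<ge> (int q + 1) * (int q ^ 2 + int q + 1) \<and>
         (x = (int q + 1) * (int q ^ 2 + int q + 1) \<longrightarrow>
           (\<exists>S. line_spread S \<and> \<L> = {\<pi>. pg_plane \<pi> \<and> (\<exists>l\<in>S. l \<subseteq> \<pi>)}))"
proof (cases "x \<le> (int q + 1) * (int q ^ 2 + int q + 1)")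
  case False
  then show ?thesis by simp
next
  \<comment> \<open>Above the bound both claims are immediate. Here the locale applies and forces
    equality, together with the spread.\<close>
  case True
  define N :: int where "N = (\<Sum>i<CARD('n) - 2. int q ^ i)"
  have q2: "q \<ge> 2"
    using card_field_ge_2[where 'a = 'a] assms(1) by simp
  have "(real q - 1) * real_of_int N = real q ^ (n - 1) - 1"
    using assms(2) by (simp add: N_def power_diff_1_eq)
  moreover have "(real q - 1) * (real q ^ 2 + real q + 1) = real q ^ 3 - 1"
    by (simp add: algebra_simps eval_nat_numeral)
  \<comment> \<open>Write the numerator of \<open>lambda2\<close> as
    \<open>(q ^ (n - 1) - 1) - (q ^ 3 - 1)\<close> and factor out \<open>q - 1\<close>.\<close>
  ultimately have "real q ^ (n - 1) - real q ^ 3 =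
      (real q - 1) * (real_of_int N - (real q ^ 2 + real q + 1))"
    by (simp add: algebra_simps)
  then have lambda2: "lambda2 = real_of_int N - (real q ^ 2 + real q + 1) - real q - 1"
    using assms(5) q2 by simp
  interpret plane_system \<L> x "int q" N
  proof
    show "int q = int CARD('a)" using assms(1) by simp
    show "N = (\<Sum>i<CARD('n) - 2. int q ^ i)" by (rule N_def)
    show "10 \<le> CARD('n)" using assms(2,3) by simp
    show "pg_plane \<pi>" if "\<pi> \<in> \<L>" for \<pi> using assms(6) that by blast
    then have sum: "(\<Sum>l \<in> lines_in \<pi>. int (card (planes_on \<L> l))) =
        int (card {\<sigma> \<in> \<L>. \<sigma> \<noteq> \<pi> \<and> pg_line (\<pi> \<inter> \<sigma>)}) +
        (if \<pi> \<in> \<L> then int q ^ 2 + int q + 1 else 0)" if "pg_plane \<pi>" for \<pi>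
      using sum_card_planes_on[of \<L> \<pi>] that assms(1) by (simp flip: of_nat_sum)
    show "0 < x" by (rule assms(7))
    show "x \<le> (int q + 1) * ((int q)\<^sup>2 + int q + 1)" by (rule True)
    show "(\<Sum>l \<in> lines_in \<pi>. int (card (planes_on \<L> l))) = x"
      if "pg_plane \<pi>" "\<pi> \<notin> \<L>" for \<pi>
    proof -
      have "{\<sigma> \<in> \<L>. \<sigma> \<noteq> \<pi> \<and> pg_line (\<pi> \<inter> \<sigma>)} = {\<sigma> \<in> \<L>. pg_line (\<pi> \<inter> \<sigma>)}"
        using that by auto
      then show ?thesis using sum[of \<pi>] assms(8) that by simp
    qed
    show "(\<Sum>l \<in> lines_in \<pi>. int (card (planes_on \<L> l))) = x + N - int q - 1"
      if "\<pi> \<in> \<L>" for \<pi>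
    proof -
      have "real (card {\<sigma> \<in> \<L>. \<sigma> \<noteq> \<pi> \<and> pg_line (\<pi> \<inter> \<sigma>)}) =
          real_of_int (N - (int q ^ 2 + int q + 1) - int q - 1 + x)"
        using assms(9) that lambda2 by simp
      then have "int (card {\<sigma> \<in> \<L>. \<sigma> \<noteq> \<pi> \<and> pg_line (\<pi> \<inter> \<sigma>)}) =
          N - (int q ^ 2 + int q + 1) - int q - 1 + x"
        by linarith
      then show ?thesis using sum[of \<pi>] assms(6) that by simp
    qed
  qed
  show ?thesis
    using x_eq line_spread_S L_eq by blast
qed

end
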